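(* Let $R$ be a commutative ring and let $n\in\mathbb{N}$. Every nullcyclic $n\times n$-matrix over $R$ is principled.
   Context: All rings are commutative, associative and unital; $\mathbb{N}=\{0,1,2,\ldots\}$ and $[n]:=\{1,2,\ldots,n\}$. Let $A=(a_{i,j})_{i,j\in[n]}$ be a matrix over $R$. For $S\subseteq[n]$, $A_S$ denotes the principal submatrix of $A$ with row and column set $S$; the empty determinant is $1$. $A$ is principled if $\det A_S=\prod_{i\in S}a_{i,i}$ for every $S\subseteq[n]$. A cycle on $[n]$ is a $k$-tuple $C=(i_1,i_2,\ldots,i_k)$ with $k>0$ and $i_1,\ldots,i_k$ distinct elements of $[n]$, considered up to cyclic rotation; it is nontrivial if $k>1$. The $A$-weight of a cycle $C=(i_1,\ldots,i_k)$ is $w_A(C):=a_{i_1,i_2}a_{i_2,i_3}\cdots a_{i_{k-1},i_k}a_{i_k,i_1}$. $A$ is nullcyclic if $w_A(C)=0$ for each nontrivial cycle $C$ on $[n]$. *)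

theory Defs
  imports "HOL-Number_Theory.Cong" "Jordan_Normal_Form.Determinant" "Jordan_Normal_Form.DL_Submatrix"
begin

text \<open>
  Class \<open>comm_ring_1\<close> excludes the zero ring. The sort \<open>{comm_ring, comm_monoid_mult}\<close> describes all
  commutative unital rings, the zero ring included. The library determinant is only available on
  \<open>comm_ring_1\<close>, so the Leibniz formula is restated here on the larger sort; the two agree wherever
  both are defined (\<open>determinant_eq_det\<close>).
  Matrix indices run over \<open>{..<n}\<close> instead of \<open>{1..n}\<close>, following the matrix library.
\<close>

definition determinant :: "'a :: {comm_ring, comm_monoid_mult} mat \<Rightarrow> 'a" where
  "determinant A =
     (if dim_row A = dim_col A
      then \<Sum>p | p permutes {0..<dim_row A}.
             (let t = \<Prod>i = 0..<dim_row A. A $$ (i, p i) in if evenperm p then t else - t)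
      else 0)"

lemma determinant_eq_det: "determinant A = det A"
  for A :: "'a :: comm_ring_1 mat"
  unfolding determinant_def det_def
  by (auto simp: sign_def Let_def intro!: sum.cong)

lemma determinant_empty: "determinant A = 1" if "A \<in> carrier_mat 0 0"
  using that by (auto simp: determinant_def)

definition principled :: "'a :: {comm_ring, comm_monoid_mult} mat \<Rightarrow> bool" where
  "principled A \<longleftrightarrow>
     (\<forall>S \<subseteq> {..<dim_row A}. determinant (submatrix A S S) = (\<Prod>i\<in>S. A $$ (i, i)))"

text \<open>
  A cycle is represented by any list of its entries; the weight and the nontriviality of a cycle
  do not depend on the choice of a rotation (\<open>is_cycle_rotate\<close>, \<open>cycle_weight_rotate\<close>).
\<close>

definition is_cycle :: "nat \<Rightarrow> nat list \<Rightarrow> bool" where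
  "is_cycle n c \<longleftrightarrow> c \<noteq> [] \<and> distinct c \<and> set c \<subseteq> {..<n}"

definition nontrivial_cycle :: "nat \<Rightarrow> nat list \<Rightarrow> bool" where
  "nontrivial_cycle n c \<longleftrightarrow> is_cycle n c \<and> length c > 1"

definition cycle_weight :: "'a :: comm_monoid_mult mat \<Rightarrow> nat list \<Rightarrow> 'a" where
  "cycle_weight A c = (\<Prod>k<length c. A $$ (c ! k, c ! (Suc k mod length c)))"

lemma is_cycle_rotate: "is_cycle n (rotate m c) = is_cycle n c"
  by (simp add: is_cycle_def)

lemma cycle_weight_rotate: "cycle_weight A (rotate m c) = cycle_weight A c"
proof (cases "c = []")
  case False
  define L where "L = length c"
  have L: "L > 0" using False by (simp add: L_def)
  define f where "f j = A $$ (c ! j, c ! (Suc j mod L))" for j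
  have "inj_on (\<lambda>k. (m + k) mod L) {..<L}"
  proof (rule inj_onI)
    fix x y assume xy: "x \<in> {..<L}" "y \<in> {..<L}" "(m + x) mod L = (m + y) mod L"
    then have "[m + x = m + y] (mod L)" by (simp add: cong_def)
    then have "[x = y] (mod L)" by (simp add: cong_add_lcancel_nat)
    then show "x = y" using xy by (simp add: cong_def)
  qed
  moreover have "(\<lambda>k. (m + k) mod L) ` {..<L} \<subseteq> {..<L}" using L by auto
  ultimately have bij: "bij_betw (\<lambda>k. (m + k) mod L) {..<L} {..<L}"
    by (simp add: bij_betw_def endo_inj_surj)
  have "cycle_weight A (rotate m c) = (\<Prod>k<L. f ((m + k) mod L))"
    unfolding cycle_weight_def f_def L_def length_rotate using False
    by (intro prod.cong refl) (simp add: nth_rotate mod_simps)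
  also have "\<dots> = (\<Prod>k<L. f k)"
    by (rule prod.reindex_bij_betw[OF bij])
  finally show ?thesis by (simp add: cycle_weight_def f_def L_def)
qed simp

definition nullcyclic :: "'a :: {comm_ring, comm_monoid_mult} mat \<Rightarrow> bool" where
  "nullcyclic A \<longleftrightarrow> (\<forall>c. nontrivial_cycle (dim_row A) c \<longrightarrow> cycle_weight A c = 0)"

end

theory Submission
  imports Defs "HOL-Combinatorics.Cycles"
begin

text \<open>
  The property of being nullcyclic passes to principal submatrices, because a cycle of
  \<open>submatrix A S S\<close> relabels to a cycle of \<open>A\<close> of the same weight
  (\<open>nullcyclic_submatrix\<close>). It therefore suffices to see that the determinant of a nullcyclic
  matrix is the product of its diagonal entries (\<open>determinant_nullcyclic\<close>). This holds because in
  the Leibniz formula a permutation \<open>p\<close> that moves some index \<open>a\<close> contributes zero: the entries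
  \<open>A $$ (i, p i)\<close> with \<open>i\<close> in the orbit of \<open>a\<close> multiply to the weight of a nontrivial cycle
  (\<open>cycle_weight_support\<close>), so the whole product has a factor zero. Only the identity
  permutation remains.
\<close>

text \<open>
  Walking along the list \<open>[a, p a, p (p a), \<dots>]\<close>, the step that wraps around from the last
  entry to the first is again an application of \<open>p\<close>, since \<open>least_power p a\<close> is the length of the
  orbit. Thus the weight is indexed by the entries themselves instead of by positions.
\<close>

lemma cycle_weight_support:
  assumes "permutation p"
  shows "cycle_weight A (support p a) = (\<Prod>i\<in>set (support p a). A $$ (i, p i))"
proof -
  let ?L = "least_power p a"
  have next_entry: "(p ^^ (Suc k mod ?L)) a = p ((p ^^ k) a)" if "k < ?L" for k
  proof (cases "Suc k = ?L")
    case True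
    have "p ((p ^^ k) a) = a"
      using least_power_of_permutation(1)[OF assms, of a] by (simp flip: True)
    then show ?thesis
      by (simp add: True)
  next
    case False
    then show ?thesis using that by simp
  qed
  have "cycle_weight A (support p a) = (\<Prod>k<?L. A $$ ((p ^^ k) a, p ((p ^^ k) a)))"
    unfolding cycle_weight_def by (rule prod.cong) (auto simp: next_entry)
  also have "\<dots> = (\<Prod>i\<in>set (support p a). A $$ (i, p i))"
    using cycle_of_permutation[OF assms, of a]
    by (simp add: distinct_map prod.reindex atLeast0LessThan)
  finally show ?thesis .
qed

lemma nontrivial_cycle_support:
  assumes p: "p permutes {0..<n}" and moved: "p a \<noteq> a"
  shows "nontrivial_cycle n (support p a)"
proof -
  have perm: "permutation p"
    using p permutation_permutes by blast
  have "a \<in> {0..<n}"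
    using p moved by (auto simp: permutes_def)
  then have "(p ^^ k) a \<in> {0..<n}" for k
    using permutes_in_image[OF permutes_funpow[OF p]] by blast
  then have "set (support p a) \<subseteq> {..<n}"
    by auto
  then show ?thesis
    using least_power_gt_one[OF perm moved] cycle_of_permutation[OF perm, of a]
    by (auto simp: nontrivial_cycle_def is_cycle_def)
qed

lemma Leibniz_term_nullcyclic_eq_0:
  fixes A :: "'a :: {comm_ring, comm_monoid_mult} mat"
  assumes A: "A \<in> carrier_mat n n" and null: "nullcyclic A"
    and p: "p permutes {0..<n}" and "p \<noteq> id"
  shows "(\<Prod>i = 0..<n. A $$ (i, p i)) = 0"
proof -
  obtain a where "p a \<noteq> a"
    using \<open>p \<noteq> id\<close> by (auto simp: fun_eq_iff)
  then have cyc: "nontrivial_cycle n (support p a)"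
    by (rule nontrivial_cycle_support[OF p])
  let ?C = "set (support p a)"
  have "?C \<subseteq> {0..<n}"
    using cyc unfolding nontrivial_cycle_def is_cycle_def by (auto simp only: atLeast0LessThan)
  then have "(\<Prod>i = 0..<n. A $$ (i, p i))
      = (\<Prod>i\<in>{0..<n} - ?C. A $$ (i, p i)) * (\<Prod>i\<in>?C. A $$ (i, p i))"
    by (rule prod.subset_diff) simp
  also have "(\<Prod>i\<in>?C. A $$ (i, p i)) = cycle_weight A (support p a)"
    using p permutation_permutes by (intro cycle_weight_support[symmetric]) blast
  also have "\<dots> = 0"
    using null A cyc by (auto simp: nullcyclic_def)
  finally show ?thesis by simp
qed

lemma determinant_nullcyclic:
  fixes A :: "'a :: {comm_ring, comm_monoid_mult} mat"
  assumes A: "A \<in> carrier_mat n n" and null: "nullcyclic A"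
  shows "determinant A = (\<Prod>i<n. A $$ (i, i))"
proof -
  let ?term = "\<lambda>p. let t = \<Prod>i = 0..<n. A $$ (i, p i) in if evenperm p then t else - t"
  have "determinant A = (\<Sum>p | p permutes {0..<n}. ?term p)"
    using A by (simp add: determinant_def)
  also have "\<dots> = (\<Sum>p\<in>{id}. ?term p)"
    by (rule sum.mono_neutral_right)
      (auto simp: finite_permutations permutes_id Leibniz_term_nullcyclic_eq_0[OF A null])
  also have "\<dots> = (\<Prod>i<n. A $$ (i, i))"
    by (simp add: evenperm_id atLeast0LessThan)
  finally show ?thesis .
qed

lemma bij_betw_pick:
  assumes "finite S"
  shows "bij_betw (pick S) {..<card S} S"
proof -
  have "inj_on (pick S) {..<card S}"
    by (rule inj_on_inverseI[where g = "\<lambda>i. card {a \<in> S. a < i}"]) (simp add: card_pick_le)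
  moreover have "pick S ` {..<card S} \<subseteq> S"
    using pick_in_set_le by auto
  ultimately show ?thesis
    using assms by (simp add: bij_betw_def card_image card_subset_eq)
qed

text \<open>
  Since \<open>submatrix\<close> discards the indices that lie outside the matrix, its dimension is \<open>card S\<close>
  because \<open>S \<subseteq> {..<n}\<close>.
\<close>

lemma principal_submatrix:
  assumes A: "A \<in> carrier_mat n n" and S: "S \<subseteq> {..<n}"
  shows "submatrix A S S \<in> carrier_mat (card S) (card S)"
    and "\<lbrakk>i < card S; j < card S\<rbrakk> \<Longrightarrow> submatrix A S S $$ (i, j) = A $$ (pick S i, pick S j)"
proof -
  have rows: "{i. i < dim_row A \<and> i \<in> S} = S" and cols: "{j. j < dim_col A \<and> j \<in> S} = S"
    using A S by auto
  show "submatrix A S S \<in> carrier_mat (card S) (card S)"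
    by (rule carrier_matI) (simp_all only: dim_submatrix rows cols)
  show "submatrix A S S $$ (i, j) = A $$ (pick S i, pick S j)" if "i < card S" "j < card S"
    using submatrix_index[of i A S j S] that by (simp only: rows cols)
qed

lemma nullcyclic_submatrix:
  fixes A :: "'a :: {comm_ring, comm_monoid_mult} mat"
  assumes A: "A \<in> carrier_mat n n" and null: "nullcyclic A" and S: "S \<subseteq> {..<n}"
  shows "nullcyclic (submatrix A S S)"
  unfolding nullcyclic_def
proof (intro allI impI)
  fix c
  assume "nontrivial_cycle (dim_row (submatrix A S S)) c"
  then have c: "nontrivial_cycle (card S) c"
    using principal_submatrix(1)[OF A S] by simp
  then have entries: "c ! k < card S" if "k < length c" for k
    using that nth_mem by (fastforce simp: nontrivial_cycle_def is_cycle_def)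
  have pick: "bij_betw (pick S) {..<card S} S"
    using S finite_subset by (intro bij_betw_pick) blast
  have "nontrivial_cycle n (map (pick S) c)"
    using c S bij_betw_imp_surj_on[OF pick] inj_on_subset[OF bij_betw_imp_inj_on[OF pick]]
    by (fastforce simp: nontrivial_cycle_def is_cycle_def distinct_map)
  moreover have "cycle_weight (submatrix A S S) c = cycle_weight A (map (pick S) c)"
    unfolding cycle_weight_def
  proof (rule prod.cong)
    fix k
    assume "k \<in> {..<length (map (pick S) c)}"
    then have "k < length c" and "Suc k mod length c < length c"
      by (auto intro: mod_less_divisor)
    then show "submatrix A S S $$ (c ! k, c ! (Suc k mod length c)) =
        A $$ (map (pick S) c ! k, map (pick S) c ! (Suc k mod length (map (pick S) c)))"
      by (simp add: principal_submatrix(2)[OF A S] entries)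
  qed simp
  ultimately show "cycle_weight (submatrix A S S) c = 0"
    using null A by (auto simp: nullcyclic_def)
qed

theorem proposition2p1:
  fixes A :: "'a :: {comm_ring, comm_monoid_mult} mat" and n :: nat
  assumes "A \<in> carrier_mat n n"
    and "nullcyclic A"
  shows "principled A"
  unfolding principled_def
proof (intro allI impI)
  fix S
  assume "S \<subseteq> {..<dim_row A}"
  then have S: "S \<subseteq> {..<n}"
    using assms(1) by simp
  note sub = principal_submatrix[OF assms(1) S]
  have "determinant (submatrix A S S) = (\<Prod>i<card S. submatrix A S S $$ (i, i))"
    using determinant_nullcyclic[OF sub(1) nullcyclic_submatrix[OF assms S]] .
  also have "\<dots> = (\<Prod>i<card S. A $$ (pick S i, pick S i))"
    by (simp add: sub(2))
  also have "\<dots> = (\<Prod>i\<in>S. A $$ (i, i))"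
    using S finite_subset by (intro prod.reindex_bij_betw bij_betw_pick) blast
  finally show "determinant (submatrix A S S) = (\<Prod>i\<in>S. A $$ (i, i))" .
qed

end
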